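(* Let $G$ be a finitely generated group of exponential growth and let $H\neq\{1\}$ be a finite group. Let $d$ be a word metric (with respect to a finite generating set) on the wreath product $H\wr G$. Then: (1) all asymptotic cones of $(H\wr G,\log(1+d))$ are ultrametric; (2) $\operatorname{asdim}_{AN}(H\wr G,\log(1+d))=\infty$.
   Context: $H\wr G=\left(\bigoplus_{g\in G}H\right)\rtimes G$, with $G$ acting by shifting coordinates. $\log(1+d)$ denotes the metric $(x,y)\mapsto\log(1+d(x,y))$. Asymptotic cones: for a non-principal ultrafilter $\omega$ on $\mathbb{N}$, a sequence $c$ and positive reals $d_n$ with $\lim_\omega d_n=\infty$, $\operatorname{Cone}_\omega(X,c,d)$ is the set of sequences $(x_n)$ with $\lim_\omega \rho(x_n,c_n)/d_n<\infty$ with pseudometric $\lim_\omega\rho(x_n,y_n)/d_n$, modulo distance zero ($\rho$ the metric of $X$). Ultrametric: $\rho(x,y)\le\max\{\rho(x,z),\rho(y,z)\}$. $\operatorname{asdim}_{AN}(X)$ is the least $n$ such that for some constants $C>0,k$ and every $s>0$ there is a cover $\{\mathcal U_0,\dots,\mathcal U_n\}$ of $X$ whose members have $s$-scale connected components (classes of "joined by a chain $x_0,\dots,x_m$ inside the set with consecutive distances $<s$") of diameter $\le Cs+k$; $\infty$ if no such $n$. *)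

theory Defs
  imports Complex_Main "HOL-Algebra.Generated_Groups" "HOL-Library.Extended_Real"
    "HOL-Library.Extended_Nat"
begin

definition gen_set :: "('a, 'b) monoid_scheme \<Rightarrow> 'a set \<Rightarrow> bool" where
  "gen_set K S \<longleftrightarrow> finite S \<and> S \<subseteq> carrier K \<and> generate K S = carrier K"

definition fin_generated :: "('a, 'b) monoid_scheme \<Rightarrow> bool" where
  "fin_generated K \<longleftrightarrow> (\<exists>S. gen_set K S)"

definition word_len :: "('a, 'b) monoid_scheme \<Rightarrow> 'a set \<Rightarrow> 'a \<Rightarrow> nat" where
  "word_len K S x = (LEAST n. \<exists>l. length l = n \<and> set l \<subseteq> S \<union> (m_inv K ` S)
      \<and> foldr (\<otimes>\<^bsub>K\<^esub>) l \<one>\<^bsub>K\<^esub> = x)"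

definition word_dist :: "('a, 'b) monoid_scheme \<Rightarrow> 'a set \<Rightarrow> 'a \<Rightarrow> 'a \<Rightarrow> real" where
  "word_dist K S x y = real (word_len K S (inv\<^bsub>K\<^esub> x \<otimes>\<^bsub>K\<^esub> y))"

text \<open>Exponential growth: the growth function of the ball of radius n
  is bounded below by c^n for some c > 1 (equivalently, the growth rate
  lim |B(n)|^(1/n) exceeds 1; independent of the generating set).\<close>
definition exp_growth :: "('a, 'b) monoid_scheme \<Rightarrow> bool" where
  "exp_growth K \<longleftrightarrow> (\<exists>S. gen_set K S \<and> (\<exists>c::real. c > 1 \<and>
      (\<forall>n. c ^ n \<le> real (card {x \<in> carrier K. word_len K S x \<le> n}))))"

definition fin_supp_fun :: "('g, 'c) monoid_scheme \<Rightarrow> ('h, 'd) monoid_scheme \<Rightarrow> ('g \<Rightarrow> 'h) \<Rightarrow> bool" where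
  "fin_supp_fun G H f \<longleftrightarrow> f \<in> extensional (carrier G) \<and> f ` carrier G \<subseteq> carrier H
      \<and> finite {x \<in> carrier G. f x \<noteq> \<one>\<^bsub>H\<^esub>}"

text \<open>H wr G = (direct sum over G of H) \<rtimes> G, with (g.f)(x) = f(g^-1 x).\<close>
definition wreath :: "('h, 'd) monoid_scheme \<Rightarrow> ('g, 'c) monoid_scheme \<Rightarrow> (('g \<Rightarrow> 'h) \<times> 'g) monoid" where
  "wreath H G = \<lparr> carrier = {(f, g). fin_supp_fun G H f \<and> g \<in> carrier G},
     mult = (\<lambda>(f1, g1) (f2, g2).
        (\<lambda>x. if x \<in> carrier G then f1 x \<otimes>\<^bsub>H\<^esub> f2 (inv\<^bsub>G\<^esub> g1 \<otimes>\<^bsub>G\<^esub> x) else undefined,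
         g1 \<otimes>\<^bsub>G\<^esub> g2)),
     one = (\<lambda>x. if x \<in> carrier G then \<one>\<^bsub>H\<^esub> else undefined, \<one>\<^bsub>G\<^esub>) \<rparr>"

definition nonprincipal_ultrafilter :: "nat filter \<Rightarrow> bool" where
  "nonprincipal_ultrafilter F \<longleftrightarrow> F \<noteq> bot \<and>
     (\<forall>P. eventually P F \<or> eventually (\<lambda>n. \<not> P n) F) \<and>
     (\<forall>m. eventually (\<lambda>n. n \<noteq> m) F)"

definition omega_lim :: "nat filter \<Rightarrow> (nat \<Rightarrow> real) \<Rightarrow> ereal" where
  "omega_lim F u = Lim F (\<lambda>n. ereal (u n))"

text \<open>Points of Cone_omega(X, c, d) (before identifying points at distance 0)
  and the induced pseudometric.\<close>
definition cone_points :: "nat filter \<Rightarrow> 'a set \<Rightarrow> ('a \<Rightarrow> 'a \<Rightarrow> real) \<Rightarrow> (nat \<Rightarrow> 'a) \<Rightarrow> (nat \<Rightarrow> real) \<Rightarrow> (nat \<Rightarrow> 'a) set" where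
  "cone_points F X \<rho> c d = {x. (\<forall>n. x n \<in> X) \<and> omega_lim F (\<lambda>n. \<rho> (x n) (c n) / d n) < \<infinity>}"

definition cone_dist :: "nat filter \<Rightarrow> ('a \<Rightarrow> 'a \<Rightarrow> real) \<Rightarrow> (nat \<Rightarrow> real) \<Rightarrow> (nat \<Rightarrow> 'a) \<Rightarrow> (nat \<Rightarrow> 'a) \<Rightarrow> ereal" where
  "cone_dist F \<rho> d x y = omega_lim F (\<lambda>n. \<rho> (x n) (y n) / d n)"

text \<open>All asymptotic cones of (X, rho) are ultrametric. The ultrametric inequality
  on the quotient by distance zero is the same as on representatives.\<close>
definition all_cones_ultrametric :: "'a set \<Rightarrow> ('a \<Rightarrow> 'a \<Rightarrow> real) \<Rightarrow> bool" where
  "all_cones_ultrametric X \<rho> \<longleftrightarrow>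
     (\<forall>F c d. nonprincipal_ultrafilter F \<and> (\<forall>n. c n \<in> X) \<and> (\<forall>n. d n > 0)
        \<and> filterlim d at_top F \<longrightarrow>
       (\<forall>x\<in>cone_points F X \<rho> c d. \<forall>y\<in>cone_points F X \<rho> c d. \<forall>z\<in>cone_points F X \<rho> c d.
          cone_dist F \<rho> d x y \<le> max (cone_dist F \<rho> d x z) (cone_dist F \<rho> d y z)))"

definition scale_conn :: "('a \<Rightarrow> 'a \<Rightarrow> real) \<Rightarrow> real \<Rightarrow> 'a set \<Rightarrow> 'a \<Rightarrow> 'a \<Rightarrow> bool" where
  "scale_conn \<rho> s U x y \<longleftrightarrow> x \<in> U \<and> (\<lambda>a b. a \<in> U \<and> b \<in> U \<and> \<rho> a b < s)\<^sup>*\<^sup>* x y"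

definition AN_cover_ok :: "'a set \<Rightarrow> ('a \<Rightarrow> 'a \<Rightarrow> real) \<Rightarrow> nat \<Rightarrow> bool" where
  "AN_cover_ok X \<rho> n \<longleftrightarrow> (\<exists>C k::real. C > 0 \<and> (\<forall>s>0. \<exists>U :: nat \<Rightarrow> 'a set.
      (\<forall>i\<le>n. U i \<subseteq> X) \<and> X \<subseteq> (\<Union>i\<le>n. U i) \<and>
      (\<forall>i\<le>n. \<forall>x y z. scale_conn \<rho> s (U i) x y \<and> scale_conn \<rho> s (U i) x z
          \<longrightarrow> \<rho> y z \<le> C * s + k)))"

definition asdim_AN :: "'a set \<Rightarrow> ('a \<Rightarrow> 'a \<Rightarrow> real) \<Rightarrow> enat" where
  "asdim_AN X \<rho> = (if \<exists>n. AN_cover_ok X \<rho> n then enat (LEAST n. AN_cover_ok X \<rho> n) else \<infinity>)"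

end

theory Submission
  imports Defs "HOL-Analysis.Extended_Real_Limits" "HOL-Real_Asymp.Real_Asymp"
begin

text \<open>
  (1) The metric \<open>ln (1 + d)\<close> satisfies the ultrametric inequality up to the additive constant
  \<open>ln 2\<close>, which disappears after rescaling.

  (2) Let \<open>B\<close> be the ball of radius \<open>m\<close> in \<open>G\<close> and fix \<open>h \<noteq> 1\<close> in \<open>H\<close>. The subsets of \<open>B\<close> embed
  into the wreath product as the lamp configurations with value \<open>h\<close> on the subset; switching one
  lamp costs \<open>O(m)\<close>, whereas the distance is bounded below by a multiple of the Hamming distance.
  A cover of finite Assouad--Nagata type for \<open>ln (1 + d)\<close> would colour the hypercube \<open>Pow B\<close> by
  \<open>n + 1\<close> colours so that any two sets of one colour at Hamming distance at most 2 are in the same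
  component, and components have Hamming diameter at most \<open>D\<close>, with \<open>D\<close> polynomial in \<open>m\<close>. A set
  of diameter \<open>D\<close> in the hypercube expands by a factor of about \<open>|B| / D\<close> when passing to its
  1-neighbourhood, and the 1-neighbourhoods of distinct components of one colour are disjoint.
  Hence every colour has density at most about \<open>D / |B|\<close>, so \<open>|B|\<close> is polynomial in \<open>m\<close>,
  contradicting exponential growth.
\<close>

section \<open>Word length\<close>

abbreviation word_prod :: "('a, 'b) monoid_scheme \<Rightarrow> 'a list \<Rightarrow> 'a" where
  "word_prod K l \<equiv> foldr (\<otimes>\<^bsub>K\<^esub>) l \<one>\<^bsub>K\<^esub>"

lemma (in group) word_prod_closed: "set l \<subseteq> carrier G \<Longrightarrow> word_prod G l \<in> carrier G"
  by (induction l) auto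

lemma (in group) word_prod_append:
  "set l \<subseteq> carrier G \<Longrightarrow> set m \<subseteq> carrier G \<Longrightarrow>
    word_prod G (l @ m) = word_prod G l \<otimes> word_prod G m"
  by (induction l) (auto simp: m_assoc word_prod_closed)

lemma (in group) letters_closed:
  "gen_set G S \<Longrightarrow> S \<union> m_inv G ` S \<subseteq> carrier G"
  by (auto simp: gen_set_def)

lemma (in group) inv_word_prod:
  "set l \<subseteq> carrier G \<Longrightarrow> inv (word_prod G l) = word_prod G (rev (map (m_inv G) l))"
proof (induction l)
  case (Cons a l)
  then have "word_prod G (rev (map (m_inv G) l) @ [inv a]) = inv (word_prod G l) \<otimes> inv a"
    by (subst word_prod_append) auto
  with Cons show ?case by (simp add: inv_mult_group word_prod_closed)
qed simp

text \<open>\<open>word_len\<close> is a \<open>LEAST\<close>, so it is meaningful only once some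
  word over \<open>S\<close> and its inverses is known to represent \<open>x\<close>.\<close>

lemma (in group) ex_word:
  assumes S: "gen_set G S" and x: "x \<in> carrier G"
  shows "\<exists>l. set l \<subseteq> S \<union> m_inv G ` S \<and> word_prod G l = x"
proof -
  have SG: "S \<subseteq> carrier G" and "x \<in> generate G S" using S x by (auto simp: gen_set_def)
  from this(2) show ?thesis
  proof (induction rule: generate.induct)
    case one
    show ?case by (rule exI[of _ "[]"]) simp
  next
    case (incl h)
    with SG show ?case by (intro exI[of _ "[h]"]) auto
  next
    case (inv h)
    with SG show ?case by (intro exI[of _ "[inv h]"]) auto
  next
    case (eng h1 h2)
    then obtain l m where "set l \<subseteq> S \<union> m_inv G ` S" "word_prod G l = h1"
      "set m \<subseteq> S \<union> m_inv G ` S" "word_prod G m = h2" by blast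
    moreover from this letters_closed[OF S] have "word_prod G (l @ m) = h1 \<otimes> h2"
      by (subst word_prod_append) auto
    ultimately show ?case by (intro exI[of _ "l @ m"]) auto
  qed
qed

lemma word_len_le:
  "set l \<subseteq> S \<union> m_inv K ` S \<Longrightarrow> word_prod K l = x \<Longrightarrow> word_len K S x \<le> length l"
  unfolding word_len_def by (rule Least_le) auto

lemma (in group) ex_shortest_word:
  assumes "gen_set G S" and "x \<in> carrier G"
  obtains l where "length l = word_len G S x" "set l \<subseteq> S \<union> m_inv G ` S" "word_prod G l = x"
proof -
  let ?P = "\<lambda>n. \<exists>l. length l = n \<and> set l \<subseteq> S \<union> m_inv G ` S \<and> word_prod G l = x"
  have "\<exists>n. ?P n" using ex_word[OF assms] by blast
  then have "?P (LEAST n. ?P n)" by (rule LeastI_ex)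
  with that show thesis unfolding word_len_def by blast
qed

lemma (in group) word_len_one: "word_len G S \<one> = 0"
  using word_len_le[of "[]" S G \<one>] by simp

lemma (in group) word_len_mult:
  assumes S: "gen_set G S" and x: "x \<in> carrier G" and y: "y \<in> carrier G"
  shows "word_len G S (x \<otimes> y) \<le> word_len G S x + word_len G S y"
proof -
  obtain l m where l: "length l = word_len G S x" "set l \<subseteq> S \<union> m_inv G ` S" "word_prod G l = x"
    and m: "length m = word_len G S y" "set m \<subseteq> S \<union> m_inv G ` S" "word_prod G m = y"
    by (metis ex_shortest_word S x y)
  with letters_closed[OF S] have "word_prod G (l @ m) = x \<otimes> y"
    by (subst word_prod_append) auto
  with l m word_len_le[of "l @ m" S G] show ?thesis by auto
qed

lemma (in group) word_len_inv:
  assumes S: "gen_set G S" and x: "x \<in> carrier G"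
  shows "word_len G S (inv x) = word_len G S x"
proof -
  have le: "word_len G S (inv x) \<le> word_len G S x" if x: "x \<in> carrier G" for x
  proof -
    obtain l where l: "length l = word_len G S x" "set l \<subseteq> S \<union> m_inv G ` S" "word_prod G l = x"
      using ex_shortest_word[OF S x] .
    have SG: "S \<subseteq> carrier G" using S by (simp add: gen_set_def)
    have "set (rev (map (m_inv G) l)) \<subseteq> S \<union> m_inv G ` S"
      using l(2) SG by (force simp: image_iff subset_iff)
    moreover have "word_prod G (rev (map (m_inv G) l)) = inv x"
      using inv_word_prod[of l] l letters_closed[OF S] by (metis subset_trans)
    ultimately show ?thesis using word_len_le[of "rev (map (m_inv G) l)" S G] l(1) by simp
  qed
  from le[OF x] le[of "inv x"] x show ?thesis by simp
qed

lemma (in group) word_dist_commute: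
  assumes "gen_set G S" "x \<in> carrier G" "y \<in> carrier G"
  shows "word_dist G S x y = word_dist G S y x"
  using word_len_inv[OF assms(1), of "inv x \<otimes> y"] assms(2,3)
  by (simp add: word_dist_def inv_mult_group)

lemma (in group) word_dist_triangle:
  assumes "gen_set G S" "x \<in> carrier G" "y \<in> carrier G" "z \<in> carrier G"
  shows "word_dist G S x y \<le> word_dist G S x z + word_dist G S z y"
proof -
  have "z \<otimes> (inv z \<otimes> y) = y" using assms(3,4) by (simp flip: m_assoc)
  then have "inv x \<otimes> y = (inv x \<otimes> z) \<otimes> (inv z \<otimes> y)"
    using assms(2-4) by (simp add: m_assoc)
  with word_len_mult[OF assms(1), of "inv x \<otimes> z" "inv z \<otimes> y"] assms(2-4) show ?thesis
    by (simp add: word_dist_def flip: of_nat_add)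
qed

text \<open>\<open>P\<close> sums \<nu> over the finitely many letters and so bounds it on each of
  them; subadditivity then extends the bound along a shortest word. It serves both to compare word
  lengths in \<open>G\<close> and in the wreath product and to bound the number of lit
  lamps.\<close>

lemma (in group) subadditive_le_word_len:
  fixes \<nu> :: "'a \<Rightarrow> nat"
  assumes S: "gen_set G S" and one: "\<nu> \<one> = 0"
    and mult: "\<And>x y. x \<in> carrier G \<Longrightarrow> y \<in> carrier G \<Longrightarrow> \<nu> (x \<otimes> y) \<le> \<nu> x + \<nu> y"
  shows "\<exists>P. \<forall>x\<in>carrier G. \<nu> x \<le> P * word_len G S x"
proof -
  let ?A = "S \<union> m_inv G ` S"
  define P where "P = sum \<nu> ?A"
  have fin: "finite ?A" using S by (simp add: gen_set_def)
  have word: "\<nu> (word_prod G l) \<le> P * length l" if "set l \<subseteq> ?A" for l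
    using that
  proof (induction l)
    case (Cons a l)
    have "\<nu> a \<le> P" unfolding P_def using Cons.prems fin by (intro member_le_sum) auto
    moreover have "\<nu> (a \<otimes> word_prod G l) \<le> \<nu> a + \<nu> (word_prod G l)"
      using Cons.prems letters_closed[OF S] by (intro mult word_prod_closed) auto
    ultimately show ?case using Cons by simp
  qed (simp add: one)
  have "\<nu> x \<le> P * word_len G S x" if "x \<in> carrier G" for x
    using ex_shortest_word[OF S that] word by metis
  then show ?thesis by blast
qed

section \<open>Asymptotic cones of logarithmic metrics\<close>

text \<open>Without convergence the value \<open>Lim F u\<close> would be arbitrary. The limit is
  the supremum of the eventual lower bounds, which always exists in \<open>ereal\<close>; the
  ultrafilter property turns "not eventually above \<open>a\<close>" into "eventually below
  \<open>a\<close>".\<close>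

lemma ultrafilter_converges:
  fixes u :: "nat \<Rightarrow> ereal"
  assumes F: "nonprincipal_ultrafilter F"
  shows "(u \<longlongrightarrow> Lim F u) F"
proof -
  define L where "L = Sup {a. eventually (\<lambda>n. a \<le> u n) F}"
  have "(u \<longlongrightarrow> L) F"
  proof (rule order_tendstoI)
    fix a assume "a < L"
    then obtain b where "a < b" "eventually (\<lambda>n. b \<le> u n) F"
      unfolding L_def less_Sup_iff by auto
    then show "eventually (\<lambda>n. a < u n) F" by (auto elim: eventually_mono)
  next
    fix a assume "L < a"
    then have "\<not> eventually (\<lambda>n. a \<le> u n) F"
      unfolding L_def using Sup_upper[of a] by (auto simp: not_le[symmetric])
    then have "eventually (\<lambda>n. \<not> a \<le> u n) F"
      using F unfolding nonprincipal_ultrafilter_def by blast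
    then show "eventually (\<lambda>n. u n < a) F" by (simp add: not_le)
  qed
  moreover have "F \<noteq> bot" using F by (simp add: nonprincipal_ultrafilter_def)
  ultimately show ?thesis by (metis tendsto_Lim)
qed

text \<open>Rescaling by \<open>d n\<close> turns the error \<open>K\<close> into
  \<open>K / d n\<close>, which tends to 0.\<close>

lemma all_cones_ultrametric_if_ultrametric_up_to_const:
  assumes \<rho>: "\<And>x y z. x \<in> X \<Longrightarrow> y \<in> X \<Longrightarrow> z \<in> X \<Longrightarrow> \<rho> x y \<le> K + max (\<rho> x z) (\<rho> y z)"
  shows "all_cones_ultrametric X \<rho>"
  unfolding all_cones_ultrametric_def
proof (intro allI impI ballI, elim conjE)
  fix F c d x y z
  assume F: "nonprincipal_ultrafilter F" and d: "\<forall>n. 0 < d n" "filterlim d at_top F"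
    and "x \<in> cone_points F X \<rho> c d" "y \<in> cone_points F X \<rho> c d" "z \<in> cone_points F X \<rho> c d"
  then have X: "x n \<in> X" "y n \<in> X" "z n \<in> X" for n by (auto simp: cone_points_def)
  have nb: "F \<noteq> bot" using F by (simp add: nonprincipal_ultrafilter_def)
  let ?M = "max (cone_dist F \<rho> d x z) (cone_dist F \<rho> d y z)"
  let ?m = "\<lambda>n. max (ereal (\<rho> (x n) (z n) / d n)) (ereal (\<rho> (y n) (z n) / d n))"
  have lim: "((\<lambda>n. ereal (u n)) \<longlongrightarrow> omega_lim F u) F" for u
    unfolding omega_lim_def by (rule ultrafilter_converges[OF F])
  have m: "(?m \<longlongrightarrow> ?M) F"
    unfolding cone_dist_def by (intro tendsto_max lim)
  have "((\<lambda>n. K / d n) \<longlongrightarrow> 0) F"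
    using d(2) by (intro real_tendsto_divide_at_top[OF tendsto_const])
  \<comment> \<open>One summand has a finite limit, so addition in \<open>ereal\<close> is
    continuous here whatever the value of \<open>?M\<close>.\<close>
  then have "((\<lambda>n. ereal (K / d n) + ?m n) \<longlongrightarrow> ereal 0 + ?M) F"
    by (intro tendsto_add_ereal_general2 m) (simp_all add: tendsto_ereal)
  moreover have "ereal (\<rho> (x n) (y n) / d n) \<le> ereal (K / d n) + ?m n" for n
  proof -
    have "\<rho> (x n) (y n) / d n \<le> (K + max (\<rho> (x n) (z n)) (\<rho> (y n) (z n))) / d n"
      using d(1) by (intro divide_right_mono \<rho> X) (simp add: less_imp_le)
    also have "\<dots> = K / d n + max (\<rho> (x n) (z n) / d n) (\<rho> (y n) (z n) / d n)"
      using d(1) by (simp add: add_divide_distrib max_divide_distrib_right less_imp_le)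
    finally show ?thesis by (simp flip: ereal_max)
  qed
  ultimately show "cone_dist F \<rho> d x y \<le> ?M"
    using tendsto_le[OF nb _ lim] unfolding cone_dist_def by simp
qed

text \<open>The triangle inequality gives \<open>d \<le> a + b \<le> 2 * max a b\<close>, and the
  logarithm turns the factor 2 into the additive constant \<open>ln 2\<close>.\<close>

lemma (in group) all_cones_ultrametric_ln_word_dist:
  assumes S: "gen_set G S"
  shows "all_cones_ultrametric (carrier G) (\<lambda>x y. ln (1 + word_dist G S x y))"
proof (rule all_cones_ultrametric_if_ultrametric_up_to_const[where K = "ln 2"])
  fix x y z assume X: "x \<in> carrier G" "y \<in> carrier G" "z \<in> carrier G"
  define a where "a = word_dist G S x z"
  define b where "b = word_dist G S y z"
  have pos: "0 \<le> word_dist G S x y" "0 \<le> a" "0 \<le> b" by (simp_all add: a_def b_def word_dist_def)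
  have "word_dist G S x y \<le> a + b"
    using word_dist_triangle[OF S X] word_dist_commute[OF S X(2,3)] by (simp add: a_def b_def)
  then have "ln (1 + word_dist G S x y) \<le> ln (2 * (1 + max a b))"
    using pos by (intro ln_mono) auto
  also have "\<dots> = ln 2 + ln (1 + max a b)" using pos by (subst ln_mult) auto
  also have "ln (1 + max a b) = max (ln (1 + a)) (ln (1 + b))" using pos by (auto simp: max_def)
  finally show "ln (1 + word_dist G S x y) \<le> ln 2 + max (ln (1 + a)) (ln (1 + b))" .
qed

section \<open>Coverings of the hypercube\<close>

lemma hypercube_colour_class_bound:
  fixes p :: "'a set \<Rightarrow> 'a set"
  assumes B: "finite B" and U: "U \<subseteq> Pow B"
    and near: "\<And>A. A \<in> U \<Longrightarrow> p A \<subseteq> B \<and> card (sym_diff A (p A)) \<le> D"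
    and same: "\<And>A A'. A \<in> U \<Longrightarrow> A' \<in> U \<Longrightarrow> card (sym_diff A A') \<le> 2 \<Longrightarrow> p A = p A'"
  shows "(card B - D) * card U \<le> (D + 1) * 2 ^ card B"
proof -
  \<comment> \<open>Count the flips that lead away from the centre \<open>p A\<close>: by \<open>same\<close>, all flips with the same
    end point \<open>Y\<close> share one centre, and each flips a coordinate in which \<open>Y\<close> differs from it.\<close>
  define W where "W = (SIGMA A:U. B - sym_diff A (p A))"
  define \<phi> where "\<phi> w = sym_diff (fst w) {snd w}" for w :: "'a set \<times> 'a"
  have fin: "finite U" "finite W" "\<And>A. A \<in> U \<Longrightarrow> finite A"
    using B U finite_subset[of _ B] by (auto simp: W_def finite_subset[of U "Pow B"])
  have img: "\<phi> ` W \<subseteq> Pow B" using U by (fastforce simp: W_def \<phi>_def)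
  \<comment> \<open>Lower bound of the double count: at least \<open>card B - D\<close> flips lead
    away from the centre at each \<open>A\<close>.\<close>
  have "card B - D \<le> card (B - sym_diff A (p A))" if "A \<in> U" for A
    using diff_card_le_card_Diff[of "sym_diff A (p A)" B] near[OF that] fin(3)[OF that] B
      finite_subset[of "p A" B] by fastforce
  then have "(\<Sum>A\<in>U. card B - D) \<le> (\<Sum>A\<in>U. card (B - sym_diff A (p A)))"
    by (rule sum_mono)
  also have "\<dots> = card W" using fin B by (simp add: W_def card_SigmaI)
  also have "\<dots> = (\<Sum>Y\<in>Pow B. card {w \<in> W. \<phi> w = Y})"
    using sum.group[OF fin(2) _ img, of "\<lambda>_. 1::nat"] B by simp
  also have "\<dots> \<le> (\<Sum>Y\<in>Pow B. D + 1)"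
  proof (rule sum_mono)
    fix Y assume Y: "Y \<in> Pow B"
    show "card {w \<in> W. \<phi> w = Y} \<le> D + 1"
    proof (cases "{w \<in> W. \<phi> w = Y} = {}")
      case False
      then obtain A b where "(A, b) \<in> W" "\<phi> (A, b) = Y" by auto
      then have A: "A \<in> U" "b \<in> B - sym_diff A (p A)" "Y = sym_diff A {b}"
        by (auto simp: W_def \<phi>_def)
      have finp: "finite (p A)" using near[OF A(1)] B finite_subset by blast
      have inj: "inj_on snd {w \<in> W. \<phi> w = Y}"
        by (auto simp: inj_on_def \<phi>_def)
      have sub: "snd ` {w \<in> W. \<phi> w = Y} \<subseteq> sym_diff Y (p A)"
      proof
        fix b' assume "b' \<in> snd ` {w \<in> W. \<phi> w = Y}"
        then obtain A' where "(A', b') \<in> W" "Y = \<phi> (A', b')" by auto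
        then have A': "A' \<in> U" "b' \<in> B - sym_diff A' (p A')" "Y = sym_diff A' {b'}"
          by (auto simp: W_def \<phi>_def)
        \<comment> \<open>\<open>A\<close> and \<open>A'\<close> are each one flip away from
          \<open>Y\<close>; this is why \<open>same\<close> is required up to Hamming distance
          2.\<close>
        have "sym_diff A A' \<subseteq> {b, b'}" using A(3) A'(3) by blast
        from card_mono[OF _ this] have "card (sym_diff A A') \<le> 2"
          by (simp add: card_insert_if split: if_splits)
        with same[OF A(1) A'(1)] A'(2,3)
        show "b' \<in> sym_diff Y (p A)" by auto
      qed
      have fin': "finite (sym_diff Y (p A))" using finp fin(3)[OF A(1)] A(3) by auto
      \<comment> \<open>The extra 1 in \<open>D + 1\<close> is the flip \<open>b\<close> that leads
        from \<open>A\<close> to \<open>Y\<close>.\<close>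
      have "sym_diff Y (p A) \<subseteq> insert b (sym_diff A (p A))" using A(3) by auto
      then have "card (sym_diff Y (p A)) \<le> card (insert b (sym_diff A (p A)))"
        using finp fin(3)[OF A(1)] by (intro card_mono) auto
      also have "\<dots> \<le> D + 1"
        using near[OF A(1)] finp fin(3)[OF A(1)] by (simp add: card_insert_if)
      finally show ?thesis using card_inj_on_le[OF inj sub fin'] by simp
    next
      case True
      then show ?thesis by (simp only: card.empty)
    qed
  qed
  finally show ?thesis using B by (simp add: card_Pow mult.commute)
qed

text \<open>\<open>p i A\<close> stands for a centre of the component of \<open>A\<close> in colour
  \<open>i\<close>. Adding the bounds for the \<open>n + 1\<close> colours, which together contain
  all \<open>2 ^ card B\<close> vertices, lets that factor cancel.\<close>

lemma hypercube_cover_bound: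
  fixes p :: "nat \<Rightarrow> 'a set \<Rightarrow> 'a set"
  assumes B: "finite B" and U: "\<And>i. i \<le> n \<Longrightarrow> U i \<subseteq> Pow B" and cover: "Pow B \<subseteq> (\<Union>i\<le>n. U i)"
    and near: "\<And>i A. i \<le> n \<Longrightarrow> A \<in> U i \<Longrightarrow> p i A \<subseteq> B \<and> card (sym_diff A (p i A)) \<le> D"
    and same: "\<And>i A A'. i \<le> n \<Longrightarrow> A \<in> U i \<Longrightarrow> A' \<in> U i \<Longrightarrow> card (sym_diff A A') \<le> 2
      \<Longrightarrow> p i A = p i A'"
  shows "card B \<le> (n + 2) * (D + 1)"
proof -
  have "2 ^ card B = card (Pow B)" using B by (simp add: card_Pow)
  also have "\<dots> \<le> card (\<Union>i\<le>n. U i)"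
    using cover U B by (intro card_mono) (auto intro: finite_subset)
  also have "\<dots> \<le> (\<Sum>i\<le>n. card (U i))" by (rule card_UN_le) simp
  finally have "(card B - D) * 2 ^ card B \<le> (\<Sum>i\<le>n. (card B - D) * card (U i))"
    by (simp flip: sum_distrib_left)
  also have "\<dots> \<le> (\<Sum>i\<le>n. (D + 1) * 2 ^ card B)"
  proof (rule sum_mono)
    fix i assume "i \<in> {..n}"
    then have i: "i \<le> n" by simp
    show "(card B - D) * card (U i) \<le> (D + 1) * 2 ^ card B"
      by (rule hypercube_colour_class_bound[OF B U[OF i] near[OF i] same[OF i]])
  qed
  finally have "(card B - D) * 2 ^ card B \<le> ((n + 1) * (D + 1)) * 2 ^ card B"
    by (simp add: algebra_simps)
  then have "card B - D \<le> (n + 1) * (D + 1)" by (rule mult_right_le_imp_le) simp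
  \<comment> \<open>Moving \<open>D\<close> to the right costs at most one more
    \<open>D + 1\<close>, hence \<open>n + 2\<close>.\<close>
  then show ?thesis by (simp add: algebra_simps)
qed

section \<open>Hypercubes in wreath products\<close>

locale wreath_product = G: group G + H: group H
  for G :: "('g, 'c) monoid_scheme" and H :: "('h, 'd) monoid_scheme"
begin

abbreviation W where "W \<equiv> wreath H G"

definition supp :: "('g \<Rightarrow> 'h) \<Rightarrow> 'g set" where
  "supp f = {x \<in> carrier G. f x \<noteq> \<one>\<^bsub>H\<^esub>}"

text \<open>The restriction produces the extensional functions that the carrier demands, so that
  total functions can be used as arguments.\<close>

definition lamps :: "('g \<Rightarrow> 'h) \<Rightarrow> ('g \<Rightarrow> 'h) \<times> 'g" where
  "lamps f = (restrict f (carrier G), \<one>\<^bsub>G\<^esub>)"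

definition shift :: "'g \<Rightarrow> ('g \<Rightarrow> 'h) \<times> 'g" where
  "shift g = (\<lambda>x\<in>carrier G. \<one>\<^bsub>H\<^esub>, g)"

section \<open>Group structure of the wreath product\<close>

lemma W_carrier:
  "(f, g) \<in> carrier W \<longleftrightarrow> f \<in> extensional (carrier G) \<and> (\<forall>x\<in>carrier G. f x \<in> carrier H)
    \<and> finite (supp f) \<and> g \<in> carrier G"
  by (auto simp: wreath_def fin_supp_fun_def supp_def)

lemma W_mult:
  "(f1, g1) \<otimes>\<^bsub>W\<^esub> (f2, g2) =
    (\<lambda>x\<in>carrier G. f1 x \<otimes>\<^bsub>H\<^esub> f2 (inv\<^bsub>G\<^esub> g1 \<otimes>\<^bsub>G\<^esub> x), g1 \<otimes>\<^bsub>G\<^esub> g2)"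
  by (simp add: wreath_def restrict_def)

lemma W_one: "\<one>\<^bsub>W\<^esub> = (\<lambda>x\<in>carrier G. \<one>\<^bsub>H\<^esub>, \<one>\<^bsub>G\<^esub>)"
  by (simp add: wreath_def restrict_def)

text \<open>This gives both closure under multiplication and subadditivity of the number of lit
  lamps.\<close>

lemma supp_mult_subset:
  assumes "g \<in> carrier G"
  shows "supp (\<lambda>x\<in>carrier G. f1 x \<otimes>\<^bsub>H\<^esub> f2 (inv\<^bsub>G\<^esub> g \<otimes>\<^bsub>G\<^esub> x))
    \<subseteq> supp f1 \<union> (\<lambda>x. g \<otimes>\<^bsub>G\<^esub> x) ` supp f2"
proof
  fix x assume x: "x \<in> supp (\<lambda>x\<in>carrier G. f1 x \<otimes>\<^bsub>H\<^esub> f2 (inv\<^bsub>G\<^esub> g \<otimes>\<^bsub>G\<^esub> x))"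
  then have xG: "x \<in> carrier G" by (simp add: supp_def)
  have eq: "x = g \<otimes>\<^bsub>G\<^esub> (inv\<^bsub>G\<^esub> g \<otimes>\<^bsub>G\<^esub> x)" using assms xG by (simp flip: G.m_assoc)
  show "x \<in> supp f1 \<union> (\<lambda>x. g \<otimes>\<^bsub>G\<^esub> x) ` supp f2"
  proof (cases "f2 (inv\<^bsub>G\<^esub> g \<otimes>\<^bsub>G\<^esub> x) = \<one>\<^bsub>H\<^esub>")
    case True
    with x show ?thesis by (auto simp: supp_def)
  next
    case False
    with xG assms have "inv\<^bsub>G\<^esub> g \<otimes>\<^bsub>G\<^esub> x \<in> supp f2" by (simp add: supp_def)
    with eq show ?thesis by blast
  qed
qed

lemma W_mult_closed: "x \<in> carrier W \<Longrightarrow> y \<in> carrier W \<Longrightarrow> x \<otimes>\<^bsub>W\<^esub> y \<in> carrier W"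
  by (cases x; cases y)
    (auto simp: W_carrier W_mult intro: finite_subset[OF supp_mult_subset])

lemma W_group: "group W"
proof (rule groupI)
  show "\<one>\<^bsub>W\<^esub> \<in> carrier W" by (simp add: W_one W_carrier supp_def)
next
  fix x y z assume "x \<in> carrier W" "y \<in> carrier W" "z \<in> carrier W"
  then show "x \<otimes>\<^bsub>W\<^esub> y \<otimes>\<^bsub>W\<^esub> z = x \<otimes>\<^bsub>W\<^esub> (y \<otimes>\<^bsub>W\<^esub> z)"
    by (cases x; cases y; cases z)
      (auto simp: W_carrier W_mult H.m_assoc G.m_assoc G.inv_mult_group intro!: restrict_ext)
next
  fix x assume "x \<in> carrier W"
  then show "\<one>\<^bsub>W\<^esub> \<otimes>\<^bsub>W\<^esub> x = x"
    by (cases x) (auto simp: W_carrier W_mult W_one intro!: extensionalityI[of _ "carrier G"])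
next
  fix x assume x: "x \<in> carrier W"
  obtain f g where fg: "x = (f, g)" by (cases x)
  \<comment> \<open>The inverse in a semidirect product: invert \<open>f\<close> pointwise and
    translate it by the inverse of \<open>g\<close>.\<close>
  let ?f = "\<lambda>y\<in>carrier G. inv\<^bsub>H\<^esub> f (g \<otimes>\<^bsub>G\<^esub> y)"
  have x': "\<forall>x\<in>carrier G. f x \<in> carrier H" "finite (supp f)" "g \<in> carrier G"
    using x fg by (auto simp: W_carrier)
  have "supp ?f \<subseteq> (\<lambda>y. inv\<^bsub>G\<^esub> g \<otimes>\<^bsub>G\<^esub> y) ` supp f"
  proof
    fix y assume "y \<in> supp ?f"
    then have "y \<in> carrier G" "g \<otimes>\<^bsub>G\<^esub> y \<in> supp f" using x' by (auto simp: supp_def)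
    moreover from this x' have "y = inv\<^bsub>G\<^esub> g \<otimes>\<^bsub>G\<^esub> (g \<otimes>\<^bsub>G\<^esub> y)" by (simp flip: G.m_assoc)
    ultimately show "y \<in> (\<lambda>y. inv\<^bsub>G\<^esub> g \<otimes>\<^bsub>G\<^esub> y) ` supp f" by blast
  qed
  with x' have "finite (supp ?f)" by (meson finite_imageI finite_subset)
  then have "(?f, inv\<^bsub>G\<^esub> g) \<in> carrier W" using x' by (simp add: W_carrier)
  moreover have "(?f, inv\<^bsub>G\<^esub> g) \<otimes>\<^bsub>W\<^esub> x = \<one>\<^bsub>W\<^esub>"
    using x' by (auto simp: fg W_mult W_one intro!: restrict_ext)
  ultimately show "\<exists>y\<in>carrier W. y \<otimes>\<^bsub>W\<^esub> x = \<one>\<^bsub>W\<^esub>" by blast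
qed (rule W_mult_closed)

sublocale W: group W by (rule W_group)

section \<open>Translations and lamp configurations as group elements\<close>

lemma shift_closed: "g \<in> carrier G \<Longrightarrow> shift g \<in> carrier W"
  by (simp add: shift_def W_carrier supp_def)

lemma shift_mult:
  "g \<in> carrier G \<Longrightarrow> g' \<in> carrier G \<Longrightarrow> shift (g \<otimes>\<^bsub>G\<^esub> g') = shift g \<otimes>\<^bsub>W\<^esub> shift g'"
  by (auto simp: shift_def W_mult intro!: restrict_ext)

lemma shift_one: "shift \<one>\<^bsub>G\<^esub> = \<one>\<^bsub>W\<^esub>"
  by (simp add: shift_def W_one)

lemma lamps_closed:
  "f \<in> carrier G \<rightarrow> carrier H \<Longrightarrow> finite (supp f) \<Longrightarrow> lamps f \<in> carrier W"
  by (auto simp: lamps_def W_carrier supp_def restrict_def extensional_def cong: conj_cong)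

lemma lamps_one: "lamps (\<lambda>_. \<one>\<^bsub>H\<^esub>) = \<one>\<^bsub>W\<^esub>"
  by (simp add: lamps_def W_one)

lemma lamps_mult: "lamps f \<otimes>\<^bsub>W\<^esub> lamps f' = lamps (\<lambda>x. f x \<otimes>\<^bsub>H\<^esub> f' x)"
  by (auto simp: lamps_def W_mult intro!: restrict_ext)

lemma inv_lamps_mult:
  assumes f: "f \<in> carrier G \<rightarrow> carrier H" "finite (supp f)"
    and f': "f' \<in> carrier G \<rightarrow> carrier H" "finite (supp f')"
  shows "inv\<^bsub>W\<^esub> lamps f \<otimes>\<^bsub>W\<^esub> lamps f' = lamps (\<lambda>x. inv\<^bsub>H\<^esub> f x \<otimes>\<^bsub>H\<^esub> f' x)"
proof -
  have supp: "supp (\<lambda>x. inv\<^bsub>H\<^esub> f x) = supp f" using f(1) by (auto simp: supp_def Pi_iff H.inv_eq_1_iff)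
  have "lamps (\<lambda>x. inv\<^bsub>H\<^esub> f x) \<otimes>\<^bsub>W\<^esub> lamps f = \<one>\<^bsub>W\<^esub>"
    unfolding lamps_mult lamps_one[symmetric] unfolding lamps_def using f(1) by (auto simp: Pi_iff intro!: restrict_ext)
  then have "inv\<^bsub>W\<^esub> lamps f = lamps (\<lambda>x. inv\<^bsub>H\<^esub> f x)"
    using f supp by (intro W.inv_equality lamps_closed) auto
  then show ?thesis by (simp add: lamps_mult)
qed

lemma shift_conj_lamps:
  assumes "g \<in> carrier G" and f: "f \<in> carrier G \<rightarrow> carrier H"
  shows "shift g \<otimes>\<^bsub>W\<^esub> lamps f \<otimes>\<^bsub>W\<^esub> shift (inv\<^bsub>G\<^esub> g) = lamps (\<lambda>x. f (inv\<^bsub>G\<^esub> g \<otimes>\<^bsub>G\<^esub> x))"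
  using assms by (auto simp: shift_def lamps_def W_mult Pi_iff intro!: restrict_ext)

definition single :: "'g \<Rightarrow> 'h \<Rightarrow> ('g \<Rightarrow> 'h) \<times> 'g" where
  "single b a = lamps (\<lambda>x. if x = b then a else \<one>\<^bsub>H\<^esub>)"

lemma single_closed: "a \<in> carrier H \<Longrightarrow> single b a \<in> carrier W"
  unfolding single_def
  by (intro lamps_closed) (auto simp: supp_def intro: finite_subset[of _ "{b}"])

text \<open>The lamplighter walks to \<open>b\<close>, switches the lamp there, and walks
  back.\<close>

lemma single_eq_conj:
  assumes "b \<in> carrier G" "a \<in> carrier H"
  shows "single b a = shift b \<otimes>\<^bsub>W\<^esub> single \<one>\<^bsub>G\<^esub> a \<otimes>\<^bsub>W\<^esub> shift (inv\<^bsub>G\<^esub> b)"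
proof -
  have "inv\<^bsub>G\<^esub> b \<otimes>\<^bsub>G\<^esub> x = \<one>\<^bsub>G\<^esub> \<longleftrightarrow> x = b" if "x \<in> carrier G" for x
    using assms(1) that by (metis G.inv_closed G.inv_equality G.inv_inv G.l_inv)
  then show ?thesis
    unfolding single_def using assms
    by (subst shift_conj_lamps) (auto simp: lamps_def intro!: restrict_ext)
qed

text \<open>The walk to \<open>b\<close> and the walk back each cost at most
  \<open>L * word_len G S b\<close>, since the length of \<open>shift g\<close> is subadditive in
  \<open>g\<close>.\<close>

lemma word_len_single_le:
  assumes T: "gen_set W T" and S: "gen_set G S" and a: "a \<in> carrier H"
  shows "\<exists>L. \<forall>b\<in>carrier G.
    word_len W T (single b a) \<le> 2 * L * word_len G S b + word_len W T (single \<one>\<^bsub>G\<^esub> a)"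
proof -
  have "\<exists>L. \<forall>g\<in>carrier G. word_len W T (shift g) \<le> L * word_len G S g"
    using S by (rule G.subadditive_le_word_len)
      (auto simp: shift_one shift_mult W.word_len_one shift_closed intro!: W.word_len_mult[OF T])
  then obtain L where L: "word_len W T (shift g) \<le> L * word_len G S g" if "g \<in> carrier G" for g
    by blast
  have "word_len W T (single b a) \<le> 2 * L * word_len G S b + word_len W T (single \<one>\<^bsub>G\<^esub> a)"
    if b: "b \<in> carrier G" for b
  proof -
    have ib: "inv\<^bsub>G\<^esub> b \<in> carrier G" using b by simp
    note closed = shift_closed[OF b] shift_closed[OF ib] single_closed[OF a, of "\<one>\<^bsub>G\<^esub>"]
    have "word_len W T (single b a) \<le> word_len W T (shift b) + word_len W T (single \<one>\<^bsub>G\<^esub> a)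
        + word_len W T (shift (inv\<^bsub>G\<^esub> b))"
      unfolding single_eq_conj[OF b a]
      using W.word_len_mult[OF T, of "shift b \<otimes>\<^bsub>W\<^esub> single \<one>\<^bsub>G\<^esub> a" "shift (inv\<^bsub>G\<^esub> b)"]
        W.word_len_mult[OF T, of "shift b" "single \<one>\<^bsub>G\<^esub> a"] closed by fastforce
    then show ?thesis
      using L[OF b] L[OF ib] G.word_len_inv[OF S b] by simp
  qed
  then show ?thesis by blast
qed

text \<open>The support of a product lies in the union of one support and a translate of the other,
  so its size is subadditive.\<close>

lemma card_supp_le_word_len:
  assumes T: "gen_set W T"
  shows "\<exists>P. \<forall>x\<in>carrier W. card (supp (fst x)) \<le> P * word_len W T x"
  using T
proof (rule W.subadditive_le_word_len)
  show "card (supp (fst \<one>\<^bsub>W\<^esub>)) = 0" by (simp add: W_one supp_def)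
next
  fix x y assume x: "x \<in> carrier W" and y: "y \<in> carrier W"
  obtain f1 g1 f2 g2 where xy: "x = (f1, g1)" "y = (f2, g2)" by (cases x; cases y)
  then have *: "g1 \<in> carrier G" "finite (supp f1)" "finite (supp f2)"
    using x y by (auto simp: W_carrier)
  have "card (supp (fst (x \<otimes>\<^bsub>W\<^esub> y))) \<le> card (supp f1 \<union> (\<lambda>x. g1 \<otimes>\<^bsub>G\<^esub> x) ` supp f2)"
    unfolding xy W_mult fst_conv using * by (intro card_mono supp_mult_subset) auto
  also have "\<dots> \<le> card (supp f1) + card (supp f2)"
    using card_Un_le[of "supp f1" "(\<lambda>x. g1 \<otimes>\<^bsub>G\<^esub> x) ` supp f2"]
      card_image_le[OF *(3), of "\<lambda>x. g1 \<otimes>\<^bsub>G\<^esub> x"] by linarith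
  finally show "card (supp (fst (x \<otimes>\<^bsub>W\<^esub> y))) \<le> card (supp (fst x)) + card (supp (fst y))"
    by (simp add: xy)
qed

section \<open>The hypercube of lamp configurations and its two distance estimates\<close>

definition cube :: "'h \<Rightarrow> 'g set \<Rightarrow> ('g \<Rightarrow> 'h) \<times> 'g" where
  "cube h A = lamps (\<lambda>x. if x \<in> A then h else \<one>\<^bsub>H\<^esub>)"

context
  fixes h assumes h: "h \<in> carrier H" "h \<noteq> \<one>\<^bsub>H\<^esub>"
begin

lemma cube_closed: "finite A \<Longrightarrow> cube h A \<in> carrier W"
  unfolding cube_def using h(1)
  by (intro lamps_closed) (auto simp: supp_def intro: finite_subset[of _ A])

lemma inv_cube_mult_cube:
  assumes "finite A" "finite A'"
  shows "inv\<^bsub>W\<^esub> cube h A \<otimes>\<^bsub>W\<^esub> cube h A' = lamps (\<lambda>x. if x \<in> A - A' then inv\<^bsub>H\<^esub> h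
    else if x \<in> A' - A then h else \<one>\<^bsub>H\<^esub>)"
  unfolding cube_def using assms h(1)
  by (subst inv_lamps_mult)
    (auto simp: supp_def lamps_def intro!: restrict_ext intro: finite_subset[of _ "A \<union> A'"])

text \<open>The quotient of two vertices has as many lit lamps as their Hamming distance, and lit
  lamps bound word length from below.\<close>

lemma card_sym_diff_le_word_dist:
  assumes T: "gen_set W T"
  shows "\<exists>P\<ge>0. \<forall>A A'. finite A \<longrightarrow> finite A' \<longrightarrow> A \<subseteq> carrier G \<longrightarrow> A' \<subseteq> carrier G \<longrightarrow>
    real (card (sym_diff A A')) \<le> P * word_dist W T (cube h A) (cube h A')"
proof -
  obtain P where P: "card (supp (fst x)) \<le> P * word_len W T x" if "x \<in> carrier W" for x
    using card_supp_le_word_len[OF T] by blast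
  have "real (card (sym_diff A A')) \<le> real P * word_dist W T (cube h A) (cube h A')"
    if A: "finite A" "finite A'" "A \<subseteq> carrier G" "A' \<subseteq> carrier G" for A A'
  proof -
    have "inv\<^bsub>W\<^esub> cube h A \<otimes>\<^bsub>W\<^esub> cube h A' \<in> carrier W" using cube_closed A by simp
    from P[OF this] have "card (supp (fst (inv\<^bsub>W\<^esub> cube h A \<otimes>\<^bsub>W\<^esub> cube h A')))
      \<le> real P * word_dist W T (cube h A) (cube h A')"
      unfolding word_dist_def of_nat_mult[symmetric] of_nat_le_iff .
    moreover have "supp (fst (inv\<^bsub>W\<^esub> cube h A \<otimes>\<^bsub>W\<^esub> cube h A')) = sym_diff A A'"
      using A h by (subst inv_cube_mult_cube) (auto simp: supp_def lamps_def)
    ultimately show ?thesis by simp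
  qed
  then show ?thesis by (intro exI[of _ "real P"]) simp
qed

text \<open>The differing lamps are switched one at a time. That \<open>a\<close> and
  \<open>b\<close> do not depend on \<open>m\<close> keeps the cost per lamp linear in the
  radius.\<close>

lemma word_dist_le_card_sym_diff:
  assumes T: "gen_set W T" and S: "gen_set G S"
  shows "\<exists>a\<ge>0. \<exists>b\<ge>0. \<forall>m A A'. finite A \<longrightarrow> finite A' \<longrightarrow>
    sym_diff A A' \<subseteq> {x \<in> carrier G. word_len G S x \<le> m} \<longrightarrow>
    word_dist W T (cube h A) (cube h A') \<le> real (card (sym_diff A A')) * (a * real m + b)"
proof -
  let ?M = "\<lambda>a. word_len W T (single \<one>\<^bsub>G\<^esub> a)"
  have ih: "inv\<^bsub>H\<^esub> h \<in> carrier H" using h by simp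
  obtain L1 L2 where L: "\<And>b. b \<in> carrier G \<Longrightarrow> word_len W T (single b h) \<le> 2 * L1 * word_len G S b + ?M h"
    "\<And>b. b \<in> carrier G \<Longrightarrow> word_len W T (single b (inv\<^bsub>H\<^esub> h)) \<le> 2 * L2 * word_len G S b + ?M (inv\<^bsub>H\<^esub> h)"
    using word_len_single_le[OF T S h(1)] word_len_single_le[OF T S ih] by blast
  \<comment> \<open>Adding the constants for \<open>h\<close> and for its inverse covers switching a
    lamp on as well as off.\<close>
  define r where "r m = 2 * (L1 + L2) * m + (?M h + ?M (inv\<^bsub>H\<^esub> h))" for m
  have flip: "word_dist W T (cube h A) (cube h (sym_diff A {b})) \<le> r m"
    if A: "finite A" and b: "b \<in> carrier G" "word_len G S b \<le> m" for A b m
  proof -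
    have "inv\<^bsub>W\<^esub> cube h A \<otimes>\<^bsub>W\<^esub> cube h (sym_diff A {b}) = single b (if b \<in> A then inv\<^bsub>H\<^esub> h else h)"
      using A by (subst inv_cube_mult_cube) (auto simp: single_def lamps_def intro!: restrict_ext)
    moreover have "2 * L1 * word_len G S b \<le> 2 * (L1 + L2) * m"
      "2 * L2 * word_len G S b \<le> 2 * (L1 + L2) * m"
      using b(2) by (auto intro!: mult_le_mono)
    with L[OF b(1)] have "word_len W T (single b h) \<le> r m"
      "word_len W T (single b (inv\<^bsub>H\<^esub> h)) \<le> r m"
      unfolding r_def by linarith+
    ultimately show ?thesis by (simp add: word_dist_def)
  qed
  have "word_dist W T (cube h A) (cube h (sym_diff A E)) \<le> real (card E) * r m"
    if E: "finite E" "E \<subseteq> {x \<in> carrier G. word_len G S x \<le> m}" and A: "finite A" for A E m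
    using E
  proof (induction E)
    case empty
    show ?case using cube_closed[OF A] by (simp add: word_dist_def W.word_len_one)
  next
    case (insert b E)
    have eq: "sym_diff A (insert b E) = sym_diff (sym_diff A E) {b}" using insert.hyps by auto
    have fin: "finite (sym_diff A E)" "finite (sym_diff A (insert b E))" using A insert.hyps by auto
    have "word_dist W T (cube h A) (cube h (sym_diff A (insert b E)))
      \<le> word_dist W T (cube h A) (cube h (sym_diff A E))
        + word_dist W T (cube h (sym_diff A E)) (cube h (sym_diff A (insert b E)))"
      using A fin by (intro W.word_dist_triangle[OF T] cube_closed)
    also have "\<dots> \<le> real (card E) * r m + r m"
      using insert flip[OF fin(1), of b m] unfolding eq by (intro add_mono) auto
    finally show ?case using insert.hyps by (simp add: algebra_simps)
  qed
  note bound = this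
  have "word_dist W T (cube h A) (cube h A') \<le> real (card (sym_diff A A')) * r m"
    if "finite A" "finite A'" "sym_diff A A' \<subseteq> {x \<in> carrier G. word_len G S x \<le> m}" for A A' m
  proof -
    have "sym_diff A (sym_diff A A') = A'" by auto
    with bound[of "sym_diff A A'" m A] that show ?thesis by simp
  qed
  then show ?thesis
    by (intro exI[of _ "real (2 * (L1 + L2))"] conjI exI[of _ "real (?M h + ?M (inv\<^bsub>H\<^esub> h))"])
      (simp_all add: r_def)
qed

end

end

section \<open>Assouad--Nagata dimension\<close>

lemma exp_dominates_powr:
  fixes a b c C K E :: real
  assumes "0 \<le> a" "0 < b" "0 < C" "1 < c"
  shows "\<exists>m::nat. K * (E * (a * real m + b) powr C + 1) < c ^ m"
proof -
  \<comment> \<open>Since \<open>a\<close> may be 0, \<open>a + 1\<close> is used to make the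
    leading coefficient positive; monotonicity of \<open>powr\<close> returns to \<open>a\<close>
    below. Absolute values then allow any signs of \<open>K\<close> and \<open>E\<close>.\<close>
  have "(\<lambda>m::nat. ((a + 1) * real m + b) powr C / c ^ m) \<longlonglongrightarrow> 0"
    using assms by real_asymp
  then have "(\<lambda>m::nat. \<bar>K\<bar> * (\<bar>E\<bar> * (((a + 1) * real m + b) powr C / c ^ m) + 1 / c ^ m))
      \<longlonglongrightarrow> \<bar>K\<bar> * (\<bar>E\<bar> * 0 + 0)"
    using assms by (intro tendsto_intros) (auto intro!: LIMSEQ_divide_realpow_zero)
  then have "eventually (\<lambda>m::nat. \<bar>K\<bar> * (\<bar>E\<bar> * (((a + 1) * real m + b) powr C / c ^ m) + 1 / c ^ m) < 1)
      sequentially"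
    by (rule order_tendstoD) simp
  then obtain m :: nat where
    "\<bar>K\<bar> * (\<bar>E\<bar> * (((a + 1) * real m + b) powr C / c ^ m) + 1 / c ^ m) < 1"
    by (auto simp: eventually_sequentially)
  then have "\<bar>K\<bar> * (\<bar>E\<bar> * ((a + 1) * real m + b) powr C + 1) < c ^ m"
    using assms by (simp add: field_simps)
  moreover have "K * (E * (a * real m + b) powr C + 1)
      \<le> \<bar>K\<bar> * (\<bar>E\<bar> * ((a + 1) * real m + b) powr C + 1)"
  proof -
    have "(a * real m + b) powr C \<le> ((a + 1) * real m + b) powr C"
      using assms by (intro powr_mono2) (auto simp: algebra_simps)
    then have "\<bar>E * (a * real m + b) powr C + 1\<bar> \<le> \<bar>E\<bar> * ((a + 1) * real m + b) powr C + 1"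
      by (intro order_trans[OF abs_triangle_ineq]) (simp add: abs_mult mult_left_mono)
    then have "\<bar>K\<bar> * \<bar>E * (a * real m + b) powr C + 1\<bar>
        \<le> \<bar>K\<bar> * (\<bar>E\<bar> * ((a + 1) * real m + b) powr C + 1)"
      by (rule mult_left_mono) simp
    then show ?thesis by (simp flip: abs_mult)
  qed
  ultimately show ?thesis by (intro exI[of _ m]) linarith
qed

text \<open>Equality as predicates, so that a \<open>SOME\<close> choice made from the component
  yields the same point for \<open>a\<close> and \<open>b\<close>.\<close>

lemma scale_conn_step_eq:
  assumes "a \<in> U" "b \<in> U" "\<rho> a b < s" "\<rho> b a < s"
  shows "scale_conn \<rho> s U a = scale_conn \<rho> s U b"
  using assms by (intro ext) (auto simp: scale_conn_def intro: converse_rtranclp_into_rtranclp)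

text \<open>A bound linear in \<open>s\<close> for the logarithmic metric is exponential in
  \<open>s\<close> for \<open>d\<close>. With \<open>s\<close> logarithmic in \<open>m\<close> it
  becomes a power of a linear function of \<open>m\<close>, which cannot dominate
  \<open>c ^ m\<close>.\<close>

lemma (in wreath_product) not_AN_cover_ok:
  assumes T: "gen_set W T" and growth: "exp_growth G" and H: "carrier H \<noteq> {\<one>\<^bsub>H\<^esub>}"
  shows "\<not> AN_cover_ok (carrier W) (\<lambda>x y. ln (1 + word_dist W T x y)) n"
proof
  let ?\<rho> = "\<lambda>x y. ln (1 + word_dist W T x y)"
  assume "AN_cover_ok (carrier W) ?\<rho> n"
  then obtain C k :: real where "C > 0" and cover: "\<And>s. s > 0 \<Longrightarrow> \<exists>U :: nat \<Rightarrow> _ set.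
      (\<forall>i\<le>n. U i \<subseteq> carrier W) \<and> carrier W \<subseteq> (\<Union>i\<le>n. U i) \<and>
      (\<forall>i\<le>n. \<forall>x y z. scale_conn ?\<rho> s (U i) x y \<and> scale_conn ?\<rho> s (U i) x z
          \<longrightarrow> ?\<rho> y z \<le> C * s + k)"
    unfolding AN_cover_ok_def by blast
  obtain S c where S: "gen_set G S" and c: "c > 1"
    "\<And>m. c ^ m \<le> real (card {x \<in> carrier G. word_len G S x \<le> m})"
    using growth unfolding exp_growth_def by blast
  obtain h where h: "h \<in> carrier H" "h \<noteq> \<one>\<^bsub>H\<^esub>" using H H.one_closed by blast
  obtain P where "P \<ge> 0" and P: "\<And>A A'. finite A \<Longrightarrow> finite A' \<Longrightarrow> A \<subseteq> carrier G \<Longrightarrow>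
      A' \<subseteq> carrier G \<Longrightarrow> real (card (sym_diff A A')) \<le> P * word_dist W T (cube h A) (cube h A')"
    using card_sym_diff_le_word_dist[OF h T] by metis
  obtain a b where ab: "a \<ge> 0" "b \<ge> 0" and flips: "\<forall>m A A'. finite A \<longrightarrow> finite A' \<longrightarrow>
    sym_diff A A' \<subseteq> {x \<in> carrier G. word_len G S x \<le> m} \<longrightarrow>
    word_dist W T (cube h A) (cube h A') \<le> real (card (sym_diff A A')) * (a * real m + b)"
    using word_dist_le_card_sym_diff[OF h T S] by blast
  \<comment> \<open>Chosen to contradict the final estimate; the base of \<open>powr\<close> is
    \<open>2 * r + 2\<close> for the \<open>r\<close> defined below.\<close>
  obtain m :: nat where m: "real (n + 2) * (P * exp k * (2 * a * real m + (2 * b + 2)) powr C + 1) < c ^ m"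
    using exp_dominates_powr[of "2 * a" "2 * b + 2" C c "real (n + 2)" "P * exp k"] ab \<open>C > 0\<close> c(1)
    by auto
  define B where "B = {x \<in> carrier G. word_len G S x \<le> m}"
  have "0 < c ^ m" using c(1) by simp
  with c(2)[of m] have "card B > 0" unfolding B_def by linarith
  \<comment> \<open>An infinite set has \<open>card\<close> 0, so the growth bound also yields
    finiteness of the ball.\<close>
  then have B: "finite B" "B \<subseteq> carrier G" by (auto simp: B_def card_gt_0_iff)
  define r where "r = a * real m + b"
  have "r \<ge> 0" using ab by (simp add: r_def)
  \<comment> \<open>Two flips cost at most \<open>2 * r\<close>, and
    \<open>1 + 2 * r < 2 * r + 2\<close> supplies the strict inequality required by
    \<open>scale_conn\<close>.\<close>
  define s where "s = ln (2 * r + 2)"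
  have "s > 0" using \<open>r \<ge> 0\<close> by (simp add: s_def)
  obtain U where U: "carrier W \<subseteq> (\<Union>i\<le>n. U i)" and diam: "\<forall>i\<le>n. \<forall>x y z.
      scale_conn ?\<rho> s (U i) x y \<and> scale_conn ?\<rho> s (U i) x z \<longrightarrow> ?\<rho> y z \<le> C * s + k"
    using cover[OF \<open>s > 0\<close>] by blast
  define V where "V i = {A \<in> Pow B. cube h A \<in> U i}" for i
  \<comment> \<open>The centre depends on \<open>A\<close> only through its component and is chosen
    among the vertices of the cube, where Hamming distance makes sense.\<close>
  define p where "p i A = (SOME A'. A' \<in> Pow B \<and> scale_conn ?\<rho> s (U i) (cube h A) (cube h A'))" for i A
  define D where "D = nat \<lfloor>P * exp (C * s + k)\<rfloor>"
  have fin: "finite A" "A \<subseteq> carrier G" if "A \<subseteq> B" for A using that B finite_subset by blast+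
  have "card B \<le> (n + 2) * (D + 1)"
  proof (rule hypercube_cover_bound[where U = V and p = p])
    show "Pow B \<subseteq> (\<Union>i\<le>n. V i)" using U cube_closed[OF h fin(1)] unfolding V_def by blast
  next
    fix i A assume i: "i \<le> n" and "A \<in> V i"
    then have A: "A \<subseteq> B" "scale_conn ?\<rho> s (U i) (cube h A) (cube h A)"
      by (auto simp: V_def scale_conn_def)
    \<comment> \<open>\<open>A\<close> itself is a candidate for the choice, because chains may have
      length 0.\<close>
    then have p: "p i A \<subseteq> B" "scale_conn ?\<rho> s (U i) (cube h A) (cube h (p i A))"
      unfolding p_def using someI[of "\<lambda>A'. A' \<in> Pow B \<and> scale_conn ?\<rho> s (U i) (cube h A) (cube h A')" A]
      by auto
    have "0 \<le> word_dist W T (cube h A) (cube h (p i A))" by (simp add: word_dist_def)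
    moreover have "?\<rho> (cube h A) (cube h (p i A)) \<le> C * s + k" using diam[rule_format, OF i] A(2) p(2) by blast
    ultimately have "1 + word_dist W T (cube h A) (cube h (p i A)) \<le> exp (C * s + k)"
      by (metis add_pos_nonneg exp_le_cancel_iff exp_ln zero_less_one)
    with P[OF fin(1)[OF A(1)] fin(1)[OF p(1)] fin(2)[OF A(1)] fin(2)[OF p(1)]] \<open>P \<ge> 0\<close>
    have "real (card (sym_diff A (p i A))) \<le> P * exp (C * s + k)"
      by (smt (verit) mult_left_mono)
    then show "p i A \<subseteq> B \<and> card (sym_diff A (p i A)) \<le> D"
      using p(1) by (simp add: D_def le_nat_iff le_floor_iff)
  next
    fix i A A' assume AA: "A \<in> V i" "A' \<in> V i" and card: "card (sym_diff A A') \<le> 2"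
    then have A: "A \<subseteq> B" "A' \<subseteq> B" by (auto simp: V_def)
    have "word_dist W T (cube h A) (cube h A') \<le> real (card (sym_diff A A')) * r"
      unfolding r_def using A by (intro flips[rule_format] fin) (auto simp: B_def)
    also have "\<dots> \<le> 2 * r" using card \<open>r \<ge> 0\<close> by (intro mult_right_mono) auto
    finally have "?\<rho> (cube h A) (cube h A') < s"
      unfolding s_def by (subst ln_less_cancel_iff) (auto simp: word_dist_def intro: add_pos_nonneg)
    moreover from this have "?\<rho> (cube h A') (cube h A) < s"
      using W.word_dist_commute[OF T cube_closed[OF h] cube_closed[OF h]] A fin by metis
    ultimately have "scale_conn ?\<rho> s (U i) (cube h A) = scale_conn ?\<rho> s (U i) (cube h A')"
      using AA by (intro scale_conn_step_eq) (auto simp: V_def)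
    then show "p i A = p i A'" by (simp add: p_def)
  qed (auto simp: V_def B)
  then have "c ^ m \<le> real ((n + 2) * (D + 1))"
    using c(2)[of m, folded B_def] by (meson of_nat_le_iff order_trans)
  also have "\<dots> = real (n + 2) * (real D + 1)" by (simp add: algebra_simps)
  also have "\<dots> \<le> real (n + 2) * (P * exp (C * s + k) + 1)"
    using \<open>P \<ge> 0\<close> by (intro mult_left_mono) (auto simp: D_def)
  \<comment> \<open>Here \<open>exp s = 2 * r + 2\<close>, so the exponential becomes a power with
    exponent \<open>C\<close>.\<close>
  also have "exp (C * s + k) = exp k * (2 * a * real m + (2 * b + 2)) powr C"
    using \<open>r \<ge> 0\<close> by (auto simp: s_def r_def powr_def exp_add algebra_simps)
  finally show False using m by (simp add: mult.assoc)
qed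

theorem theorem3p6:
  fixes G :: "('g, 'c) monoid_scheme" and H :: "('h, 'd) monoid_scheme" and T :: "(('g \<Rightarrow> 'h) \<times> 'g) set"
  assumes "group G" and "fin_generated G" and "exp_growth G"
    and "group H" and "finite (carrier H)" and "carrier H \<noteq> {\<one>\<^bsub>H\<^esub>}"
    and "gen_set (wreath H G) T"
  shows "all_cones_ultrametric (carrier (wreath H G)) (\<lambda>x y. ln (1 + word_dist (wreath H G) T x y))
     \<and> asdim_AN (carrier (wreath H G)) (\<lambda>x y. ln (1 + word_dist (wreath H G) T x y)) = \<infinity>"
proof -
  interpret wreath_product G H
    using assms(1,4) by (rule wreath_product.intro)
  show ?thesis
    using W.all_cones_ultrametric_ln_word_dist[OF assms(7)] not_AN_cover_ok[OF assms(7,3,6)]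
    by (simp add: asdim_AN_def)
qed

end
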